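(* Let $\alpha\in[0,1)$, let $\beta\in[-1,1]$, let $\{\varepsilon_n\}_{n\ge 1}\subset[0,1]$, and let $\{S_n\}$ be the elephant random walk with parameters $\alpha$, $\beta$, $\{\varepsilon_n\}$ (as defined in the context). Then $$\lim_{n\to\infty}\frac{S_n-E[S_n]}{n}=0\quad\text{a.s.}$$ If in addition $\lim_{n\to\infty}\varepsilon_n=\varepsilon$ for some $\varepsilon\in[0,1)$, then $$\lim_{n\to\infty}\frac{E[S_n]}{n}=\varepsilon\quad\text{and}\quad \lim_{n\to\infty}\frac{S_n}{n}=\varepsilon\quad\text{a.s.}$$
   Context: Elephant random walk with parameters $\alpha\in[0,1)$, $\beta\in[-1,1]$, $\{\varepsilon_n\}_{n\ge1}\subset[0,1]$: $\{X_n\}_{n\ge1}$ is a sequence of $\{+1,-1\}$-valued random variables on a probability space such that $P(X_1=+1)=q$ and $P(X_1=-1)=1-q$ with $q=(1+\beta)/2$ (so $E[X_1]=\beta$), and, with $\mathcal{F}_n$ the $\sigma$-algebra generated by $X_1,\dots,X_n$, for every $n\ge1$, $$P(X_{n+1}=\pm1\mid\mathcal{F}_n)=\alpha\cdot\frac{\#\{i=1,\dots,n: X_i=\pm1\}}{n}+(1-\alpha)\cdot\frac{1\pm\varepsilon_n}{2}.$$ The walk is $S_0:=0$, $S_n:=\sum_{i=1}^nX_i$ for $n\ge1$. *)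

theory Defs
  imports "HOL-Probability.Probability"
begin

text \<open>Steps are indexed from 1; the values \<open>X 0\<close> and \<open>\<epsilon> 0\<close> are never constrained or used.\<close>

definition gen_sigma :: "'a measure \<Rightarrow> (nat \<Rightarrow> 'a \<Rightarrow> real) \<Rightarrow> nat \<Rightarrow> 'a measure" where
  "gen_sigma M X n =
     sigma (space M) {X i -` B \<inter> space M | i B. i \<in> {1..n} \<and> B \<in> sets borel}"

text \<open>
  \<^const>\<open>real_cond_exp\<close> is constantly zero when its second argument is not a subalgebra,
  so it matters that \<open>gen_sigma M X n\<close> always is one.
\<close>

lemma subalgebra_gen_sigma:
  assumes "\<And>i. i \<ge> 1 \<Longrightarrow> X i \<in> borel_measurable M"
  shows "subalgebra M (gen_sigma M X n)"
proof -
  have "{X i -` B \<inter> space M | i B. i \<in> {1..n} \<and> B \<in> sets borel} \<subseteq> sets M"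
    using assms by (auto intro: measurable_sets)
  then show ?thesis
    unfolding subalgebra_def gen_sigma_def
    by (simp add: sets.sigma_sets_subset space_measure_of_conv)
      (metis (no_types, lifting) sets.sigma_sets_subset sets_measure_of sets.space_closed subset_trans)
qed

definition walk :: "(nat \<Rightarrow> 'a \<Rightarrow> real) \<Rightarrow> nat \<Rightarrow> 'a \<Rightarrow> real" where
  "walk X n \<omega> = (\<Sum>i=1..n. X i \<omega>)"

text \<open>
  The sign \<open>s\<close> ranges over \<open>\<plusminus>1\<close>. A conditional probability is the conditional
  expectation of an indicator; it is determined only almost surely, hence the \<open>AE\<close>.
\<close>

locale elephant_random_walk = prob_space M
  for M :: "'a measure" +
  fixes \<alpha> \<beta> :: real and \<epsilon> :: "nat \<Rightarrow> real" and X :: "nat \<Rightarrow> 'a \<Rightarrow> real"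
  assumes step_measurable: "\<And>n. n \<ge> 1 \<Longrightarrow> random_variable borel (X n)"
    and step_values: "\<And>n \<omega>. n \<ge> 1 \<Longrightarrow> \<omega> \<in> space M \<Longrightarrow> X n \<omega> \<in> {1, -1}"
    and first_step_plus: "prob {\<omega> \<in> space M. X 1 \<omega> = 1} = (1 + \<beta>) / 2"
    and first_step_minus: "prob {\<omega> \<in> space M. X 1 \<omega> = -1} = 1 - (1 + \<beta>) / 2"
    and next_step: "\<And>n s. n \<ge> 1 \<Longrightarrow> s \<in> {1, -1} \<Longrightarrow>
      AE \<omega> in M.
        real_cond_exp M (gen_sigma M X n) (indicator {\<omega> \<in> space M. X (n + 1) \<omega> = s}) \<omega>
          = \<alpha> * (real (card {i \<in> {1..n}. X i \<omega> = s}) / real n) + (1 - \<alpha>) * ((1 + s * \<epsilon> n) / 2)"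

end

theory Submission
  imports Defs
begin

text \<open>
  Write \<open>D\<^sub>n = S\<^sub>n - E[S\<^sub>n]\<close>. Given the past, the next step has mean
  \<open>\<alpha> S\<^sub>n / n + (1 - \<alpha>) \<epsilon>\<^sub>n\<close>: reinforcement pulls towards the current average, but only with
  strength \<open>\<alpha> < 1\<close>. The deterministic drift cancels in \<open>D\<^sub>n\<close>, and expanding the square gives
  \<open>E[D\<^sub>n\<^sub>+\<^sub>1\<^sup>2] \<le> (1 + 2 \<alpha> / n) E[D\<^sub>n\<^sup>2] + 1\<close>. For the averages \<open>u\<^sub>n = D\<^sub>n / n\<close>
  the division by \<open>(n + 1)\<^sup>2\<close> outweighs the growth factor, so that \<open>E[u\<^sub>n\<^sup>2]\<close> decreases by at least
  \<open>(1 - \<alpha>) E[u\<^sub>n\<^sup>2] / (n + 1)\<close>, up to the summable error \<open>1 / (n + 1)\<^sup>2\<close>. Telescoping shows that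
  \<open>\<Sum> E[u\<^sub>n\<^sup>2] / (n + 1)\<close> converges, and hence \<open>\<Sum> u\<^sub>n\<^sup>2 / (n + 1)\<close> converges almost surely
  (\<open>AE_summable_weighted_square\<close>).

  The rest of the almost sure argument is deterministic. As the steps are bounded,
  \<open>\<bar>u\<^sub>n\<^sub>+\<^sub>1 - u\<^sub>n\<bar> \<le> 4 / (n + 1)\<close>. Therefore the increments of \<open>u\<^sub>n\<^sup>3\<close> are dominated by
  \<open>u\<^sub>n\<^sup>2 / (n + 1)\<close> plus a summable term, and \<open>u\<^sub>n\<^sup>3\<close> converges. The limit is zero, since
  \<open>\<Sum> u\<^sub>n\<^sup>2 / (n + 1)\<close> converges whereas the harmonic series does not
  (\<open>slowly_varying_tendsto_zero\<close>).

  The means \<open>a\<^sub>n = E[S\<^sub>n] / n\<close> obey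
  \<open>a\<^sub>n\<^sub>+\<^sub>1 = (1 - c\<^sub>n) a\<^sub>n + c\<^sub>n \<epsilon>\<^sub>n\<close> with \<open>c\<^sub>n = (1 - \<alpha>) / (n + 1)\<close>. This is repeated averaging
  with weights of divergent sum, which forgets the initial value and follows the limit of
  \<open>\<epsilon>\<^sub>n\<close> (\<open>averaging_recursion_tendsto_zero\<close>).
\<close>

section \<open>Divergent weights and almost supermartingale bounds\<close>

text \<open>
  The deterministic core of the Robbins--Siegmund argument: what \<open>r\<close> loses cannot exceed what
  it starts with plus what it is given.
\<close>

lemma summable_if_telescoping_bound:
  fixes r a s :: "nat \<Rightarrow> real"
  assumes r: "\<And>n. 0 \<le> r n" and a: "\<And>n. 0 \<le> a n" and s: "\<And>n. 0 \<le> s n" "summable s"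
    and step: "\<And>n. r (Suc n) + a n \<le> r n + s n"
  shows "summable a"
proof (rule summableI_nonneg_bounded[where x = "r 0 + suminf s"])
  fix n
  have "r n + (\<Sum>i<n. a i) \<le> r 0 + (\<Sum>i<n. s i)"
  proof (induction n)
    case (Suc n)
    then show ?case using step[of n] by simp
  qed simp
  moreover have "(\<Sum>i<n. s i) \<le> suminf s"
    using s by (intro sum_le_suminf) auto
  ultimately show "(\<Sum>i<n. a i) \<le> r 0 + suminf s"
    using r[of n] by linarith
qed (use a in auto)

lemma frequently_small_if_weighted_summable:
  fixes c f :: "nat \<Rightarrow> real"
  assumes c: "\<And>n. 0 \<le> c n" "\<not> summable c"
    and sm: "summable (\<lambda>n. c n * f n)" and "0 < \<eta>"
  shows "\<exists>\<^sub>F n in sequentially. f n < \<eta>"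
proof (rule ccontr)
  assume "\<not> ?thesis"
  then have "\<forall>\<^sub>F n in sequentially. \<eta> \<le> f n"
    by (simp add: not_frequently not_less)
  then have "\<forall>\<^sub>F n in sequentially. norm (c n) \<le> c n * f n / \<eta>"
    by eventually_elim (use c \<open>0 < \<eta>\<close> in \<open>simp add: pos_le_divide_eq mult_left_mono\<close>)
  then have "summable c"
    using summable_divide[OF sm] by (rule summable_comparison_test_ev)
  with c(2) show False ..
qed

text \<open>
  In the increment \<open>h (3 x\<^sup>2 + 3 x h + h\<^sup>2)\<close>, with \<open>h = y - x\<close>, the mixed term is absorbed by
  \<open>2 \<bar>x h\<bar> \<le> x\<^sup>2 + h\<^sup>2\<close>. What remains is \<open>c x\<^sup>2\<close>, which is controlled by a weighted sum of
  squares, and \<open>c\<^sup>3\<close>.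
\<close>

lemma abs_cube_diff_le:
  fixes x y c K :: real
  assumes "\<bar>y - x\<bar> \<le> K * c" "0 \<le> c" "0 \<le> K"
  shows "\<bar>y ^ 3 - x ^ 3\<bar> \<le> 5 * K * (c * x\<^sup>2) + 3 * K ^ 3 * c ^ 3"
proof -
  define h where "h = y - x"
  have y: "y = x + h" by (simp add: h_def)
  have h: "\<bar>h\<bar> \<le> K * c" using assms h_def by simp
  have "y ^ 3 - x ^ 3 = h * (3 * x\<^sup>2 + 3 * (x * h) + h\<^sup>2)"
    by (simp add: y power2_eq_square power3_eq_cube algebra_simps)
  also have "\<bar>\<dots>\<bar> \<le> \<bar>h\<bar> * (5 * x\<^sup>2 + 3 * h\<^sup>2)"
  proof -
    have "0 \<le> (x + h)\<^sup>2" "0 \<le> (x - h)\<^sup>2" "0 \<le> x\<^sup>2" "0 \<le> h\<^sup>2" by auto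
    then have "\<bar>3 * x\<^sup>2 + 3 * (x * h) + h\<^sup>2\<bar> \<le> 5 * x\<^sup>2 + 3 * h\<^sup>2"
      unfolding power2_sum power2_diff abs_le_iff by (intro conjI) linarith+
    then show ?thesis
      by (simp add: abs_mult mult_left_mono)
  qed
  also have "\<dots> \<le> (K * c) * (5 * x\<^sup>2 + 3 * (K * c)\<^sup>2)"
  proof -
    have "h\<^sup>2 \<le> (K * c)\<^sup>2"
      using power_mono[OF h, of 2] by simp
    then show ?thesis
      using h assms by (intro mult_mono) auto
  qed
  also have "\<dots> = 5 * K * (c * x\<^sup>2) + 3 * K ^ 3 * c ^ 3"
    by (simp add: power2_eq_square power3_eq_cube algebra_simps)
  finally show ?thesis .
qed

text \<open>
  Summability of \<open>c\<^sub>n u\<^sub>n\<^sup>2\<close> alone only makes \<open>u\<close> small infinitely often. An excursion away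
  from zero is expensive because \<open>u\<close> moves by at most \<open>K c\<^sub>n\<close> per step: it has to spend a
  positive amount of weight there. The potential \<open>u\<^sup>3\<close> expresses this, since its derivative
  \<open>3 u\<^sup>2\<close> is, up to a constant, the quantity whose weighted sum converges. An odd power also lets \<open>u\<close> be recovered from the
  potential by a continuous root.
\<close>

lemma slowly_varying_tendsto_zero:
  fixes c u :: "nat \<Rightarrow> real"
  assumes c: "\<And>n. 0 \<le> c n" "\<not> summable c" "summable (\<lambda>n. c n ^ 3)"
    and slow: "\<And>n. \<bar>u (Suc n) - u n\<bar> \<le> K * c n" and K: "0 \<le> K"
    and sm: "summable (\<lambda>n. c n * (u n)\<^sup>2)"
  shows "u \<longlonglongrightarrow> 0"
proof -
  have "summable (\<lambda>n. 5 * K * (c n * (u n)\<^sup>2) + 3 * K ^ 3 * c n ^ 3)"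
    using sm c(3) by (intro summable_add summable_mult)
  then have "summable (\<lambda>n. u (Suc n) ^ 3 - u n ^ 3)"
    by (rule summable_comparison_test')
      (use abs_cube_diff_le[OF slow c(1) K] in simp)
  then have "(\<lambda>n. \<Sum>i<n. u (Suc i) ^ 3 - u i ^ 3) \<longlonglongrightarrow> (\<Sum>i. u (Suc i) ^ 3 - u i ^ 3)"
    by (rule summable_LIMSEQ)
  moreover have "(\<Sum>i<n. u (Suc i) ^ 3 - u i ^ 3) = u n ^ 3 - u 0 ^ 3" for n
    by (rule sum_lessThan_telescope)
  ultimately have "convergent (\<lambda>n. u n ^ 3)"
    using convergent_add_const_iff[of "- (u 0 ^ 3)" "\<lambda>n. u n ^ 3"]
    by (auto simp: convergent_def)
  then obtain L where "(\<lambda>n. u n ^ 3) \<longlonglongrightarrow> L"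
    by (auto simp: convergent_def)
  then have "(\<lambda>n. root 3 (u n ^ 3)) \<longlonglongrightarrow> root 3 L"
    by (rule tendsto_real_root)
  then obtain l where l: "u \<longlonglongrightarrow> l"
    by (auto simp: odd_real_root_power_cancel)
  have "l = 0"
  proof (rule ccontr)
    assume "l \<noteq> 0"
    then have "l\<^sup>2 / 2 < l\<^sup>2" by simp
    moreover have "(\<lambda>n. (u n)\<^sup>2) \<longlonglongrightarrow> l\<^sup>2" by (intro tendsto_intros l)
    ultimately have "\<forall>\<^sub>F n in sequentially. l\<^sup>2 / 2 < (u n)\<^sup>2"
      using order_tendstoD(1) by blast
    moreover have "\<exists>\<^sub>F n in sequentially. (u n)\<^sup>2 < l\<^sup>2 / 2"
      using \<open>l \<noteq> 0\<close> by (intro frequently_small_if_weighted_summable[OF c(1,2) sm]) auto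
    ultimately have "\<exists>\<^sub>F n in sequentially. l\<^sup>2 / 2 < (u n)\<^sup>2 \<and> (u n)\<^sup>2 < l\<^sup>2 / 2"
      by (rule frequently_eventually_conj[rotated])
    then obtain n where "(u n)\<^sup>2 < l\<^sup>2 / 2" "l\<^sup>2 / 2 < (u n)\<^sup>2"
      by (auto dest: frequently_ex)
    then show False by linarith
  qed
  with l show ?thesis by simp
qed

text \<open>
  Once \<open>\<bar>d\<^sub>n\<bar> \<le> \<eta>\<close>, the excess of \<open>\<bar>b\<^sub>n\<bar>\<close> over \<open>\<eta>\<close> shrinks by the factor \<open>1 - c\<^sub>n\<close> in each
  step. It is thus nonincreasing, and it becomes arbitrarily small because its \<open>c\<close>-weighted sum
  telescopes while \<open>\<Sum> c\<^sub>n\<close> diverges.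
\<close>

lemma averaging_recursion_tendsto_zero:
  fixes b c d :: "nat \<Rightarrow> real"
  assumes c: "\<And>n. 0 \<le> c n" "\<And>n. c n \<le> 1" "\<not> summable c"
    and d: "d \<longlonglongrightarrow> 0"
    and step: "\<And>n. b (Suc n) = (1 - c n) * b n + c n * d n"
  shows "b \<longlonglongrightarrow> 0"
proof (rule LIMSEQ_I)
  fix e :: real assume "0 < e"
  define \<eta> where "\<eta> = e / 3"
  have \<eta>: "0 < \<eta>" using \<open>0 < e\<close> by (simp add: \<eta>_def)
  obtain N where N: "\<bar>d n\<bar> \<le> \<eta>" if "n \<ge> N" for n
    using LIMSEQ_D[OF d \<eta>] by (auto intro: less_imp_le)
  define w where "w n = max 0 (\<bar>b (n + N)\<bar> - \<eta>)" for n
  have w_step: "w (Suc n) \<le> (1 - c (n + N)) * w n" for n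
  proof -
    let ?k = "n + N"
    have "\<bar>b (Suc ?k)\<bar> \<le> (1 - c ?k) * \<bar>b ?k\<bar> + c ?k * \<bar>d ?k\<bar>"
      using c(1,2)[of ?k] abs_triangle_ineq[of "(1 - c ?k) * b ?k" "c ?k * d ?k"]
      by (simp add: step abs_mult)
    also have "c ?k * \<bar>d ?k\<bar> \<le> c ?k * \<eta>"
      using c(1) N by (intro mult_left_mono) auto
    finally have "\<bar>b (Suc ?k)\<bar> - \<eta> \<le> (1 - c ?k) * (\<bar>b ?k\<bar> - \<eta>)"
      by (simp add: algebra_simps)
    also have "\<dots> \<le> (1 - c ?k) * w n"
      using c(2) by (intro mult_left_mono) (auto simp: w_def)
    finally show ?thesis
      using c(2)[of ?k] by (simp add: w_def)
  qed
  have w_nonneg: "0 \<le> w n" for n by (simp add: w_def)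
  have "summable (\<lambda>n. c (n + N) * w n)"
  proof (rule summable_if_telescoping_bound[where r = w and s = "\<lambda>_. 0"])
    show "w (Suc n) + c (n + N) * w n \<le> w n + 0" for n
      using w_step[of n] by (simp add: algebra_simps)
  qed (use c w_nonneg in auto)
  moreover have "\<not> summable (\<lambda>n. c (n + N))"
    using c(3) by simp
  ultimately have "\<exists>\<^sub>F n in sequentially. w n < \<eta>"
    using c(1) \<eta> by (intro frequently_small_if_weighted_summable[of "\<lambda>n. c (n + N)"])
  then obtain m where m: "w m < \<eta>"
    by (auto dest: frequently_ex)
  have "decseq w"
  proof (rule decseq_SucI)
    show "w (Suc n) \<le> w n" for n
      using w_step[of n] mult_nonneg_nonneg[OF c(1)[of "n + N"] w_nonneg[of n]]
      by (simp add: algebra_simps)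
  qed
  show "\<exists>no. \<forall>n\<ge>no. norm (b n - 0) < e"
  proof (intro exI allI impI)
    fix n assume "m + N \<le> n"
    then have "w (n - N) \<le> w m" "n - N + N = n"
      using \<open>decseq w\<close> by (auto simp: decseq_def)
    moreover have "\<bar>b (n - N + N)\<bar> - \<eta> \<le> w (n - N)" by (simp add: w_def)
    ultimately have "\<bar>b n\<bar> - \<eta> < \<eta>" using m by simp
    then show "norm (b n - 0) < e" using \<open>0 < e\<close> by (simp add: \<eta>_def)
  qed
qed

lemma summable_inverse_shift_power:
  assumes "2 \<le> k"
  shows "summable (\<lambda>n. (1 / (real n + 2)) ^ k)"
  using summable_ignore_initial_segment[OF inverse_power_summable[OF assms, where 'a = real], of 2]
  by (simp add: field_simps)

lemma not_summable_inverse_shift: "\<not> summable (\<lambda>n. 1 / (real n + 2))"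
  using not_summable_harmonic[where 'a = real]
    summable_iff_shift[of "\<lambda>n. inverse (real n)" 2]
  by (simp add: field_simps)

section \<open>From summable expectations to summable paths\<close>

text \<open>
  By monotone convergence the sum has a finite integral, so it is finite almost everywhere.
\<close>

lemma AE_summable_if_summable_integral:
  fixes f :: "nat \<Rightarrow> 'a \<Rightarrow> real"
  assumes int: "\<And>n. integrable M (f n)" and nonneg: "\<And>n \<omega>. 0 \<le> f n \<omega>"
    and sm: "summable (\<lambda>n. \<integral>\<omega>. f n \<omega> \<partial>M)"
  shows "AE \<omega> in M. summable (\<lambda>n. f n \<omega>)"
proof -
  have [measurable]: "f n \<in> borel_measurable M" for n
    using int by (rule borel_measurable_integrable)
  have "(\<integral>\<^sup>+ \<omega>. (\<Sum>n. ennreal (f n \<omega>)) \<partial>M) = (\<Sum>n. \<integral>\<^sup>+ \<omega>. ennreal (f n \<omega>) \<partial>M)"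
    by (rule nn_integral_suminf) simp
  also have "\<dots> = (\<Sum>n. ennreal (\<integral>\<omega>. f n \<omega> \<partial>M))"
    using int nonneg by (simp add: nn_integral_eq_integral)
  also have "\<dots> = ennreal (\<Sum>n. \<integral>\<omega>. f n \<omega> \<partial>M)"
    using nonneg sm by (intro suminf_ennreal2) auto
  finally have "(\<integral>\<^sup>+ \<omega>. (\<Sum>n. ennreal (f n \<omega>)) \<partial>M) \<noteq> \<infinity>"
    by simp
  then have "AE \<omega> in M. (\<Sum>n. ennreal (f n \<omega>)) \<noteq> \<infinity>"
    by (intro nn_integral_PInf_AE) auto
  then show ?thesis
    by eventually_elim (rule summable_suminf_not_top, use nonneg in auto)
qed

section \<open>Moments of the elephant random walk\<close>

context elephant_random_walk
begin

lemma abs_step: "n \<ge> 1 \<Longrightarrow> \<omega> \<in> space M \<Longrightarrow> \<bar>X n \<omega>\<bar> = 1"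
  using step_values[of n \<omega>] by auto

lemma abs_walk_le: "\<omega> \<in> space M \<Longrightarrow> \<bar>walk X n \<omega>\<bar> \<le> real n"
  using sum_abs[of "\<lambda>i. X i \<omega>" "{1..n}"] by (simp add: walk_def abs_step)

lemma walk_measurable [measurable]: "walk X n \<in> borel_measurable M"
  unfolding walk_def[abs_def] using step_measurable by (intro borel_measurable_sum) auto

lemma integrable_bounded:
  fixes f :: "'a \<Rightarrow> real"
  assumes "f \<in> borel_measurable M" "\<And>\<omega>. \<omega> \<in> space M \<Longrightarrow> \<bar>f \<omega>\<bar> \<le> B"
  shows "integrable M f"
  using assms by (intro integrable_const_bound[of f B]) auto

lemma integrable_walk: "integrable M (walk X n)"
  using walk_measurable abs_walk_le by (rule integrable_bounded)

lemma integrable_step: "n \<ge> 1 \<Longrightarrow> integrable M (X n)"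
  using step_measurable abs_step by (intro integrable_bounded[of "X n" 1]) auto

lemma walk_Suc: "walk X (Suc n) \<omega> = walk X n \<omega> + X (Suc n) \<omega>"
  by (simp add: walk_def)

lemma step_measurable_gen_sigma:
  assumes "i \<in> {1..n}"
  shows "X i \<in> borel_measurable (gen_sigma M X n)"
proof (rule measurableI)
  fix B :: "real set" assume "B \<in> sets borel"
  then show "X i -` B \<inter> space (gen_sigma M X n) \<in> sets (gen_sigma M X n)"
    using assms unfolding gen_sigma_def
    by (subst sets_measure_of) (auto simp: space_measure_of_conv intro!: sigma_sets.Basic)
qed simp

lemma walk_measurable_gen_sigma: "walk X n \<in> borel_measurable (gen_sigma M X n)"
  unfolding walk_def[abs_def] by (intro borel_measurable_sum step_measurable_gen_sigma)

lemma walk_eq_card_diff: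
  assumes "\<omega> \<in> space M"
  shows "walk X n \<omega> = real (card {i \<in> {1..n}. X i \<omega> = 1}) - real (card {i \<in> {1..n}. X i \<omega> = -1})"
proof -
  have "walk X n \<omega> = (\<Sum>i=1..n. of_bool (X i \<omega> = 1) - of_bool (X i \<omega> = -1))"
    unfolding walk_def using step_values[OF _ assms] by (intro sum.cong) auto
  then show ?thesis
    by (simp add: sum_subtractf Int_def)
qed

text \<open>
  The conditional law of the next step in integrated form. The step is the difference of the
  indicators of \<open>+1\<close> and \<open>-1\<close>; in the difference of the two conditional probabilities the
  counts of past signs combine to the current position. The moment recursions below test this
  identity with \<open>Z = 1\<close> and \<open>Z = D\<^sub>n\<close>.
\<close>

lemma expectation_mult_next_step:
  assumes n: "n \<ge> 1" and Z: "Z \<in> borel_measurable (gen_sigma M X n)"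
    and bd: "\<And>\<omega>. \<omega> \<in> space M \<Longrightarrow> \<bar>Z \<omega>\<bar> \<le> B"
  shows "expectation (\<lambda>\<omega>. Z \<omega> * X (Suc n) \<omega>)
    = expectation (\<lambda>\<omega>. Z \<omega> * (\<alpha> * (walk X n \<omega> / real n) + (1 - \<alpha>) * \<epsilon> n))"
proof -
  have sub: "subalgebra M (gen_sigma M X n)"
    by (rule subalgebra_gen_sigma) (rule step_measurable)
  interpret F: finite_measure_subalgebra M "gen_sigma M X n"
    by unfold_locales (rule sub)
  have Z_M [measurable]: "Z \<in> borel_measurable M"
    using sub Z by (rule measurable_from_subalg)
  have X_M [measurable]: "X (Suc n) \<in> borel_measurable M"
    by (rule step_measurable) simp
  define I where "I s = indicat_real {\<omega> \<in> space M. X (n + 1) \<omega> = s}" for s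
  have I_M [measurable]: "I s \<in> borel_measurable M" for s
    unfolding I_def by simp
  have int: "integrable M (\<lambda>\<omega>. Z \<omega> * I s \<omega>)" for s
  proof (rule integrable_bounded)
    show "\<bar>Z \<omega> * I s \<omega>\<bar> \<le> B" if "\<omega> \<in> space M" for \<omega>
      using bd[OF that] by (auto simp: I_def indicator_def)
  qed simp
  note cond = F.real_cond_exp_intg[OF int Z I_M]
  have "expectation (\<lambda>\<omega>. Z \<omega> * X (Suc n) \<omega>)
      = expectation (\<lambda>\<omega>. Z \<omega> * I 1 \<omega> - Z \<omega> * I (-1) \<omega>)"
    using step_values[of "Suc n"]
    by (intro Bochner_Integration.integral_cong) (auto simp: I_def indicator_def)
  also have "\<dots> = expectation (\<lambda>\<omega>. Z \<omega> * I 1 \<omega>) - expectation (\<lambda>\<omega>. Z \<omega> * I (-1) \<omega>)"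
    using int by (intro Bochner_Integration.integral_diff) auto
  also have "\<dots> = expectation (\<lambda>\<omega>. Z \<omega> * real_cond_exp M (gen_sigma M X n) (I 1) \<omega>)
      - expectation (\<lambda>\<omega>. Z \<omega> * real_cond_exp M (gen_sigma M X n) (I (-1)) \<omega>)"
    by (simp only: cond(2))
  also have "\<dots> = expectation (\<lambda>\<omega>. Z \<omega> * real_cond_exp M (gen_sigma M X n) (I 1) \<omega>
      - Z \<omega> * real_cond_exp M (gen_sigma M X n) (I (-1)) \<omega>)"
    using cond(1) by (intro Bochner_Integration.integral_diff[symmetric]) auto
  also have "\<dots> = expectation (\<lambda>\<omega>. Z \<omega> * (\<alpha> * (walk X n \<omega> / real n) + (1 - \<alpha>) * \<epsilon> n))"
  proof (rule integral_cong_AE)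
    have cond_prob: "AE \<omega> in M. real_cond_exp M (gen_sigma M X n) (I s) \<omega>
        = \<alpha> * (real (card {i \<in> {1..n}. X i \<omega> = s}) / real n) + (1 - \<alpha>) * ((1 + s * \<epsilon> n) / 2)"
      if "s \<in> {1, -1}" for s
      unfolding I_def using n that by (rule next_step)
    from cond_prob[of 1, OF insertI1] cond_prob[of "-1", OF insertI2[OF insertI1]] AE_space
    show "AE \<omega> in M. Z \<omega> * real_cond_exp M (gen_sigma M X n) (I 1) \<omega>
      - Z \<omega> * real_cond_exp M (gen_sigma M X n) (I (-1)) \<omega>
      = Z \<omega> * (\<alpha> * (walk X n \<omega> / real n) + (1 - \<alpha>) * \<epsilon> n)"
    proof eventually_elim
      case (elim \<omega>)
      show ?case
        unfolding elim(1,2) walk_eq_card_diff[OF elim(3)]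
        using n by (simp add: field_simps)
    qed
  qed (use cond(1) in auto)
  finally show ?thesis .
qed

lemma expectation_walk_Suc_eq_add:
  "expectation (walk X (Suc n)) = expectation (walk X n) + expectation (X (Suc n))"
proof -
  have "walk X (Suc n) = (\<lambda>\<omega>. walk X n \<omega> + X (Suc n) \<omega>)"
    by (rule ext) (rule walk_Suc)
  moreover have "expectation (\<lambda>\<omega>. walk X n \<omega> + X (Suc n) \<omega>)
      = expectation (walk X n) + expectation (X (Suc n))"
    by (intro Bochner_Integration.integral_add integrable_walk integrable_step) simp
  ultimately show ?thesis by (simp only:)
qed

lemma expectation_walk_Suc:
  assumes "n \<ge> 1"
  shows "expectation (walk X (Suc n))
    = (1 + \<alpha> / real n) * expectation (walk X n) + (1 - \<alpha>) * \<epsilon> n"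
proof -
  have "expectation (X (Suc n)) = \<alpha> / real n * expectation (walk X n) + (1 - \<alpha>) * \<epsilon> n"
    using expectation_mult_next_step[of n "\<lambda>_. 1" 1] assms integrable_walk
    by (simp add: prob_space)
  then show ?thesis
    by (simp add: expectation_walk_Suc_eq_add distrib_right)
qed

definition centered_walk :: "nat \<Rightarrow> 'a \<Rightarrow> real" where
  "centered_walk n \<omega> = walk X n \<omega> - expectation (walk X n)"

lemma centered_walk_measurable [measurable]: "centered_walk n \<in> borel_measurable M"
  unfolding centered_walk_def[abs_def] by simp

lemma abs_expectation_step_le: "n \<ge> 1 \<Longrightarrow> \<bar>expectation (X n)\<bar> \<le> 1"
  using integral_abs_bound[of M "X n"] abs_step[of n]
  by (simp add: prob_space cong: Bochner_Integration.integral_cong)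

lemma centered_walk_Suc:
  "centered_walk (Suc n) \<omega> = centered_walk n \<omega> + (X (Suc n) \<omega> - expectation (X (Suc n)))"
  by (simp add: centered_walk_def walk_Suc expectation_walk_Suc_eq_add)

lemma abs_centered_step_le:
  "\<omega> \<in> space M \<Longrightarrow> \<bar>X (Suc n) \<omega> - expectation (X (Suc n))\<bar> \<le> 2"
  using abs_step[of "Suc n" \<omega>] abs_expectation_step_le[of "Suc n"] by simp

lemma abs_centered_walk_le: "\<omega> \<in> space M \<Longrightarrow> \<bar>centered_walk n \<omega>\<bar> \<le> 2 * real n"
proof (induction n)
  case 0
  then show ?case by (simp add: centered_walk_def walk_def[abs_def])
next
  case (Suc n)
  then show ?case
    using abs_centered_step_le[of \<omega> n] by (simp add: centered_walk_Suc)
qed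

lemma integrable_centered_walk_power: "integrable M (\<lambda>\<omega>. centered_walk n \<omega> ^ k)"
proof (rule integrable_bounded)
  show "\<bar>centered_walk n \<omega> ^ k\<bar> \<le> (2 * real n) ^ k" if "\<omega> \<in> space M" for \<omega>
    unfolding power_abs using abs_centered_walk_le[OF that] by (rule power_mono) simp
qed simp

lemma expectation_centered_walk: "expectation (centered_walk n) = 0"
  using integrable_walk by (simp add: centered_walk_def[abs_def] prob_space)

text \<open>
  The cross term of the square is \<open>2 E[D\<^sub>n X\<^sub>n\<^sub>+\<^sub>1] = (2 \<alpha> / n) E[D\<^sub>n\<^sup>2]\<close>, because every
  deterministic part of the conditional mean is annihilated by the centred \<open>D\<^sub>n\<close>. The last
  summand bounds the variance \<open>1 - \<mu>\<^sup>2\<close> of a single step with mean \<open>\<mu>\<close>.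
\<close>

lemma variance_walk_Suc_le:
  assumes n: "n \<ge> 1"
  shows "expectation (\<lambda>\<omega>. (centered_walk (Suc n) \<omega>)\<^sup>2)
    \<le> (1 + 2 * \<alpha> / real n) * expectation (\<lambda>\<omega>. (centered_walk n \<omega>)\<^sup>2) + 1"
proof -
  let ?D = "centered_walk n"
  let ?X = "X (Suc n)"
  define \<mu> where "\<mu> = expectation ?X"
  define m where "m = expectation (walk X n)"
  note D_int = integrable_centered_walk_power[of n 1, simplified]
    and D2_int = integrable_centered_walk_power[of n 2]
  have X_M [measurable]: "?X \<in> borel_measurable M"
    by (rule step_measurable) simp
  have DX_int: "integrable M (\<lambda>\<omega>. ?D \<omega> * ?X \<omega>)"
    by (rule integrable_bounded[where B = "2 * real n"])
      (auto simp: abs_mult abs_step abs_centered_walk_le)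
  have X_int: "integrable M ?X" by (simp add: integrable_step)
  have "expectation (\<lambda>\<omega>. ?D \<omega> * ?X \<omega>)
      = expectation (\<lambda>\<omega>. ?D \<omega> * (\<alpha> * (walk X n \<omega> / real n) + (1 - \<alpha>) * \<epsilon> n))"
  proof (rule expectation_mult_next_step[OF n _ abs_centered_walk_le])
    show "?D \<in> borel_measurable (gen_sigma M X n)"
      unfolding centered_walk_def[abs_def] by (intro borel_measurable_diff walk_measurable_gen_sigma) simp
  qed
  also have "\<dots> = expectation (\<lambda>\<omega>. \<alpha> / real n * (?D \<omega>)\<^sup>2
      + (\<alpha> / real n * m + (1 - \<alpha>) * \<epsilon> n) * ?D \<omega>)"
    using n by (intro Bochner_Integration.integral_cong)
      (auto simp: centered_walk_def m_def power2_eq_square field_simps)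
  also have "\<dots> = \<alpha> / real n * expectation (\<lambda>\<omega>. (?D \<omega>)\<^sup>2)"
    using D_int D2_int by (simp add: expectation_centered_walk)
  finally have DX: "expectation (\<lambda>\<omega>. ?D \<omega> * ?X \<omega>) = \<alpha> / real n * expectation (\<lambda>\<omega>. (?D \<omega>)\<^sup>2)" .
  have "expectation (\<lambda>\<omega>. (centered_walk (Suc n) \<omega>)\<^sup>2)
      = expectation (\<lambda>\<omega>. (?D \<omega>)\<^sup>2 + 2 * (?D \<omega> * ?X \<omega>) - 2 * \<mu> * ?D \<omega> + (1 + \<mu>\<^sup>2) - 2 * \<mu> * ?X \<omega>)"
  proof (intro Bochner_Integration.integral_cong refl)
    fix \<omega> assume "\<omega> \<in> space M"
    then have "(?X \<omega>)\<^sup>2 = 1" using abs_step[of "Suc n" \<omega>] by (simp add: abs_square_eq_1)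
    then show "(centered_walk (Suc n) \<omega>)\<^sup>2
      = (?D \<omega>)\<^sup>2 + 2 * (?D \<omega> * ?X \<omega>) - 2 * \<mu> * ?D \<omega> + (1 + \<mu>\<^sup>2) - 2 * \<mu> * ?X \<omega>"
      by (simp add: centered_walk_Suc \<mu>_def[symmetric] power2_eq_square algebra_simps)
  qed
  also have "\<dots> = expectation (\<lambda>\<omega>. (?D \<omega>)\<^sup>2) + 2 * expectation (\<lambda>\<omega>. ?D \<omega> * ?X \<omega>) + (1 + \<mu>\<^sup>2) - 2 * \<mu> * \<mu>"
    using D_int D2_int DX_int X_int
    by (simp add: expectation_centered_walk prob_space \<mu>_def[symmetric])
  also have "\<dots> \<le> (1 + 2 * \<alpha> / real n) * expectation (\<lambda>\<omega>. (?D \<omega>)\<^sup>2) + 1"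
    unfolding DX by (simp add: distrib_right power2_eq_square[of \<mu>] mult.assoc)
  finally show ?thesis .
qed

section \<open>Strong law of large numbers\<close>

text \<open>
  With \<open>N = n + 1\<close> and \<open>r n = E[(D\<^sub>N / N)\<^sup>2]\<close>, the variance recursion reads
  \<open>(N + 1)\<^sup>2 r (n + 1) \<le> (N\<^sup>2 + 2 \<alpha> N) r n + 1\<close>. The gap between \<open>N\<^sup>2 + 2 \<alpha> N\<close> and
  \<open>(N + 1)\<^sup>2\<close> is at least \<open>(1 - \<alpha>) (N + 1)\<close>, which yields a telescoping bound.
\<close>

lemma AE_summable_weighted_square:
  assumes "\<alpha> < 1"
  shows "AE \<omega> in M. summable (\<lambda>n. 1 / (real n + 2) * (centered_walk (Suc n) \<omega> / real (Suc n))\<^sup>2)"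
proof (rule AE_summable_if_summable_integral)
  define r where "r n = expectation (\<lambda>\<omega>. (centered_walk (Suc n) \<omega> / real (Suc n))\<^sup>2)" for n
  have r_nonneg: "0 \<le> r n" for n by (simp add: r_def)
  have r_eq: "expectation (\<lambda>\<omega>. (centered_walk (Suc n) \<omega>)\<^sup>2) = (real (Suc n))\<^sup>2 * r n" for n
    by (simp add: r_def power_divide)
  have "summable (\<lambda>n. (1 - \<alpha>) * (1 / (real n + 2) * r n))"
  proof (rule summable_if_telescoping_bound[where r = r and s = "\<lambda>n. (1 / (real n + 2)) ^ 2"])
    fix n
    define N where "N = real n + 1"
    have N: "1 \<le> N" "real (Suc n) = N" "real (Suc (Suc n)) = N + 1" "real n + 2 = N + 1"
      by (auto simp: N_def)
    have "(N + 1)\<^sup>2 * r (Suc n) \<le> (1 + 2 * \<alpha> / N) * (N\<^sup>2 * r n) + 1"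
      using variance_walk_Suc_le[of "Suc n"] by (simp only: r_eq N)
    also have "\<dots> = (N\<^sup>2 + 2 * \<alpha> * N) * r n + 1"
      using N(1) by (simp add: field_simps power2_eq_square)
    finally have 1: "(N + 1)\<^sup>2 * r (Suc n) \<le> (N\<^sup>2 + 2 * \<alpha> * N) * r n + 1" .
    have "0 \<le> (1 - \<alpha>) * (N - 1)" using assms N(1) by simp
    \<comment> \<open>The difference of the two sides below is \<open>(1 - \<alpha>) (N - 1) + 1\<close>.\<close>
    then have "(N\<^sup>2 + 2 * \<alpha> * N) + (1 - \<alpha>) * (N + 1) \<le> (N + 1)\<^sup>2"
      by (simp add: power2_eq_square algebra_simps)
    from mult_right_mono[OF this r_nonneg[of n]]
    have "(N + 1)\<^sup>2 * r (Suc n) + (1 - \<alpha>) * (N + 1) * r n \<le> (N + 1)\<^sup>2 * r n + 1"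
      using 1 by (simp add: algebra_simps)
    then have "((N + 1)\<^sup>2 * r (Suc n) + (1 - \<alpha>) * (N + 1) * r n) / (N + 1)\<^sup>2
        \<le> ((N + 1)\<^sup>2 * r n + 1) / (N + 1)\<^sup>2"
      by (rule divide_right_mono) simp
    moreover have "((N + 1)\<^sup>2 * r (Suc n) + (1 - \<alpha>) * (N + 1) * r n) / (N + 1)\<^sup>2
        = r (Suc n) + (1 - \<alpha>) * (1 / (N + 1) * r n)"
      using N(1) by (simp add: add_divide_distrib power2_eq_square)
    moreover have "((N + 1)\<^sup>2 * r n + 1) / (N + 1)\<^sup>2 = r n + (1 / (N + 1)) ^ 2"
      using N(1) by (simp add: add_divide_distrib power_divide)
    ultimately show "r (Suc n) + (1 - \<alpha>) * (1 / (real n + 2) * r n) \<le> r n + (1 / (real n + 2)) ^ 2"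
      by (simp only: N)
  next
    show "summable (\<lambda>n. (1 / (real n + 2)) ^ 2)"
      by (rule summable_inverse_shift_power) simp
  qed (use assms r_nonneg in auto)
  then show "summable (\<lambda>n. expectation (\<lambda>\<omega>. 1 / (real n + 2) * (centered_walk (Suc n) \<omega> / real (Suc n))\<^sup>2))"
    using assms unfolding Bochner_Integration.integral_mult_right_zero r_def[symmetric]
    by (subst (asm) summable_cmult_iff) simp
next
  show "integrable M (\<lambda>\<omega>. 1 / (real n + 2) * (centered_walk (Suc n) \<omega> / real (Suc n))\<^sup>2)" for n
    using integrable_centered_walk_power[of "Suc n" 2]
    by (simp add: power_divide del: of_nat_Suc)
qed simp

text \<open>
  The new average differs from the old one \<open>z\<close> by \<open>(y - z) / (n + 2)\<close>, where \<open>y\<close> is the centred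
  new step; both \<open>y\<close> and \<open>z\<close> lie in \<open>[-2, 2]\<close>.
\<close>

lemma abs_centered_average_diff_le:
  assumes "\<omega> \<in> space M"
  shows "\<bar>centered_walk (Suc (Suc n)) \<omega> / real (Suc (Suc n)) - centered_walk (Suc n) \<omega> / real (Suc n)\<bar>
    \<le> 4 * (1 / (real n + 2))"
proof -
  define N where "N = real n + 1"
  have N: "1 \<le> N" "real (Suc n) = N" "real (Suc (Suc n)) = N + 1" "real n + 2 = N + 1"
    by (auto simp: N_def)
  define y where "y = X (Suc (Suc n)) \<omega> - expectation (X (Suc (Suc n)))"
  define z where "z = centered_walk (Suc n) \<omega> / N"
  have "\<bar>y\<bar> \<le> 2" using abs_centered_step_le[OF assms] by (simp add: y_def)
  have "\<bar>centered_walk (Suc n) \<omega>\<bar> \<le> 2 * N" using abs_centered_walk_le[OF assms, of "Suc n"] N by simp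
  then have "\<bar>z\<bar> \<le> 2" using N(1) by (simp add: z_def abs_divide divide_le_eq)
  have "centered_walk (Suc n) \<omega> = z * N" using N(1) by (simp add: z_def)
  then have "centered_walk (Suc (Suc n)) \<omega> / (N + 1) - z = (y - z) / (N + 1)"
    using N(1) by (simp add: centered_walk_Suc[of "Suc n"] y_def[symmetric] field_simps)
  moreover have "\<bar>(y - z) / (N + 1)\<bar> \<le> 4 / (N + 1)"
    using \<open>\<bar>y\<bar> \<le> 2\<close> \<open>\<bar>z\<bar> \<le> 2\<close> N(1) by (simp add: abs_divide divide_right_mono)
  ultimately show ?thesis by (simp only: N z_def)
qed

lemma AE_centered_average_tendsto_zero:
  assumes "\<alpha> < 1"
  shows "AE \<omega> in M. (\<lambda>n. centered_walk n \<omega> / real n) \<longlonglongrightarrow> 0"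
  using AE_summable_weighted_square[OF assms] AE_space
proof eventually_elim
  case (elim \<omega>)
  have "(\<lambda>n. centered_walk (Suc n) \<omega> / real (Suc n)) \<longlonglongrightarrow> 0"
  proof (rule slowly_varying_tendsto_zero)
    show "summable (\<lambda>n. (1 / (real n + 2)) ^ 3)"
      by (rule summable_inverse_shift_power) simp
  qed (use elim abs_centered_average_diff_le not_summable_inverse_shift in auto)
  then show ?case by (rule LIMSEQ_imp_Suc)
qed

lemma expectation_average_tendsto:
  assumes \<alpha>: "\<alpha> \<in> {0..<1}" and lim: "\<epsilon> \<longlonglongrightarrow> \<epsilon>'"
  shows "(\<lambda>n. expectation (walk X n) / real n) \<longlonglongrightarrow> \<epsilon>'"
proof -
  define a where "a n = expectation (walk X (Suc n)) / real (Suc n)" for n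
  define c where "c n = (1 - \<alpha>) * (1 / (real n + 2))" for n
  have "(\<lambda>n. a n - \<epsilon>') \<longlonglongrightarrow> 0"
  proof (rule averaging_recursion_tendsto_zero)
    show "0 \<le> c n" for n using \<alpha> by (simp add: c_def)
    show "c n \<le> 1" for n using \<alpha> unfolding c_def by (intro mult_le_one) auto
    show "\<not> summable c"
      using \<alpha> not_summable_inverse_shift unfolding c_def by (subst summable_cmult_iff) simp
    show "(\<lambda>n. \<epsilon> (Suc n) - \<epsilon>') \<longlonglongrightarrow> 0"
      using LIMSEQ_Suc[OF lim] by (simp add: LIM_zero)
    show "a (Suc n) - \<epsilon>' = (1 - c n) * (a n - \<epsilon>') + c n * (\<epsilon> (Suc n) - \<epsilon>')" for n
    proof -
      define N where "N = real n + 1"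
      have N: "1 \<le> N" "real (Suc n) = N" "real (Suc (Suc n)) = N + 1" "real n + 2 = N + 1"
        by (auto simp: N_def)
      define k where "k = 1 / (N + 1)"
      have k: "k * (N + 1) = 1" using N(1) by (simp add: k_def)
      have "expectation (walk X (Suc n)) = N * a n"
        using N(1) unfolding a_def N(2) by simp
      then have "expectation (walk X (Suc (Suc n))) = (N + \<alpha>) * a n + (1 - \<alpha>) * \<epsilon> (Suc n)"
        using expectation_walk_Suc[of "Suc n"] N(1) unfolding N(2) by (simp add: distrib_right)
      then have "a (Suc n) = k * ((N + \<alpha>) * a n + (1 - \<alpha>) * \<epsilon> (Suc n))"
        unfolding a_def[of "Suc n"] N(3) k_def by simp
      moreover have "c n = (1 - \<alpha>) * k"
        unfolding c_def N(4) k_def ..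
      ultimately show ?thesis
        using k by algebra
    qed
  qed
  then have "a \<longlonglongrightarrow> \<epsilon>'" by (rule LIM_zero_cancel)
  then show ?thesis unfolding a_def by (rule LIMSEQ_imp_Suc)
qed

end

theorem theorem2p1:
  fixes M :: "'a measure" and \<alpha> \<beta> :: real
    and \<epsilon> :: "nat \<Rightarrow> real" and X :: "nat \<Rightarrow> 'a \<Rightarrow> real"
  assumes "\<alpha> \<in> {0..<1}"
    and "\<beta> \<in> {-1..1}"
    and "\<And>n. n \<ge> 1 \<Longrightarrow> \<epsilon> n \<in> {0..1}"
    and "elephant_random_walk M \<alpha> \<beta> \<epsilon> X"
  shows "(AE \<omega> in M. (\<lambda>n. (walk X n \<omega> - integral\<^sup>L M (walk X n)) / real n) \<longlonglongrightarrow> 0) \<and>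
    (\<forall>\<epsilon>'\<in>{0..<1}. \<epsilon> \<longlonglongrightarrow> \<epsilon>' \<longrightarrow>
      (\<lambda>n. integral\<^sup>L M (walk X n) / real n) \<longlonglongrightarrow> \<epsilon>' \<and>
      (AE \<omega> in M. (\<lambda>n. walk X n \<omega> / real n) \<longlonglongrightarrow> \<epsilon>'))"
proof -
  interpret elephant_random_walk M \<alpha> \<beta> \<epsilon> X by (rule assms(4))
  have centered: "AE \<omega> in M. (\<lambda>n. (walk X n \<omega> - integral\<^sup>L M (walk X n)) / real n) \<longlonglongrightarrow> 0"
    using AE_centered_average_tendsto_zero assms(1) by (simp add: centered_walk_def)
  show ?thesis
  proof (intro conjI ballI impI)
    fix \<epsilon>' assume "\<epsilon> \<longlonglongrightarrow> \<epsilon>'"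
    with assms(1) show mean: "(\<lambda>n. integral\<^sup>L M (walk X n) / real n) \<longlonglongrightarrow> \<epsilon>'"
      by (rule expectation_average_tendsto)
    from centered show "AE \<omega> in M. (\<lambda>n. walk X n \<omega> / real n) \<longlonglongrightarrow> \<epsilon>'"
    proof eventually_elim
      case (elim \<omega>)
      then show ?case
        using tendsto_add[OF elim mean] by (simp add: diff_divide_distrib)
    qed
  qed (rule centered)
qed

end
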